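(* Let $\mathbf{G}$ be a simplicial group, let $n>1$, and let $D_n$ be the subgroup of $G_n$ generated by the degenerate elements. Let $N_n^G$ be the normal subgroup of $G_n$ generated by all elements of the form $F_{\alpha,\beta}(x_\alpha,y_\beta)$ with $(\alpha,\beta)\in P(n)$, $x_\alpha\in NG_{n-\#\alpha}$ and $y_\beta\in NG_{n-\#\beta}$. Then $$NG_n\cap D_n = N_n^G\cap D_n .$$
   Context: For a simplicial group $\mathbf{G}$ with faces $d_i$ and degeneracies $s_i$, the Moore complex has terms $NG_n=\bigcap_{i=0}^{n-1}\mathrm{Ker}\,(d_i:G_n\to G_{n-1})$, with $NG_0=G_0$ (and boundary $\partial_n$ the restriction of $d_n$). Index strings: $S(n)$ is the set of all strings $\alpha=(i_l,\ldots,i_1)$ with $0\le i_1<i_2<\cdots<i_l\le n-1$ and $0\le l\le n$ (the empty string is $\emptyset_n$). Such strings correspond to the monotone surjections from $[n]$ onto $[n-l]$, where $i_1,\dots,i_l$ are the indices $i$ at which the surjection takes equal values on $i$ and $i+1$. The length is $\#\alpha=l$, and $\alpha\cap\beta$ is the set of indices belonging to both $\alpha$ and $\beta$. Put $s_\alpha=s_{i_l}\cdots s_{i_1}:G_{n-\#\alpha}\to G_n$ ($s_{i_1}$ is applied first; $s_{\emptyset_n}$ is the identity). Order on $S(n)$: for $\alpha=(i_l,\ldots,i_1)$ and $\beta=(j_m,\ldots,j_1)$, $\alpha>\beta$ if either $i_1=j_1,\ldots,i_k=j_k$ and $i_{k+1}<j_{k+1}$ for some $k\ge 0$, or $i_1=j_1,\ldots,i_m=j_m$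 and $l>m$. For example $S(2)=\{\emptyset_2<(1)<(0)<(1,0)\}$. $P(n)$ is the set of pairs $(\alpha,\beta)$ of non-empty strings in $S(n)$ with $\alpha\cap\beta=\emptyset$ and $\beta<\alpha$. Let $p_j(z)=z\,(s_jd_j z)^{-1}$ for $z\in G_n$, $0\le j\le n-1$, and $p=p_{n-1}\cdots p_1p_0:G_n\to NG_n$ (with $p_0$ applied first). With $[a,b]=aba^{-1}b^{-1}$, the pairing $F_{\alpha,\beta}:NG_{n-\#\alpha}\times NG_{n-\#\beta}\to NG_n$ is $$F_{\alpha,\beta}(x_\alpha,y_\beta)=p\big([s_\alpha x_\alpha,\,s_\beta y_\beta]\big).$$ *)

theory Defs
  imports "HOL-Algebra.Generated_Groups"
begin

text \<open>
  A simplicial group: \<open>d n i\<close> is the face map from \<open>G n\<close> to \<open>G (n - 1)\<close>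
  (for \<open>n > 0\<close> and \<open>i \<le> n\<close>), and \<open>s n i\<close> is the degeneracy map from \<open>G n\<close> to
  \<open>G (n + 1)\<close> (for \<open>i \<le> n\<close>), so both carry the degree of their source. All groups live in
  one type \<open>'a\<close>; their carriers may be arbitrary and need not be related. Outside
  the stated ranges nothing is assumed about \<open>d\<close> and \<open>s\<close>.
\<close>

locale simplicial_group =
  fixes G :: "nat \<Rightarrow> ('a, 'b) monoid_scheme"
    and d :: "nat \<Rightarrow> nat \<Rightarrow> 'a \<Rightarrow> 'a"
    and s :: "nat \<Rightarrow> nat \<Rightarrow> 'a \<Rightarrow> 'a"
  assumes is_group: "group (G n)"
    and face_hom: "i \<le> Suc n \<Longrightarrow> d (Suc n) i \<in> hom (G (Suc n)) (G n)"
    and degeneracy_hom: "i \<le> n \<Longrightarrow> s n i \<in> hom (G n) (G (Suc n))"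
    and face_face:
      "i < j \<Longrightarrow> j \<le> n + 2 \<Longrightarrow> x \<in> carrier (G (n + 2)) \<Longrightarrow>
        d (n + 1) i (d (n + 2) j x) = d (n + 1) (j - 1) (d (n + 2) i x)"
    and degeneracy_degeneracy:
      "i \<le> j \<Longrightarrow> j \<le> n \<Longrightarrow> x \<in> carrier (G n) \<Longrightarrow>
        s (n + 1) i (s n j x) = s (n + 1) (j + 1) (s n i x)"
    and face_degeneracy_less:
      "i < j \<Longrightarrow> j \<le> n + 1 \<Longrightarrow> x \<in> carrier (G (n + 1)) \<Longrightarrow>
        d (n + 2) i (s (n + 1) j x) = s n (j - 1) (d (n + 1) i x)"
    and face_degeneracy_same:
      "j \<le> n \<Longrightarrow> x \<in> carrier (G n) \<Longrightarrow> d (n + 1) j (s n j x) = x"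
    and face_degeneracy_Suc:
      "j \<le> n \<Longrightarrow> x \<in> carrier (G n) \<Longrightarrow> d (n + 1) (j + 1) (s n j x) = x"
    and face_degeneracy_greater:
      "j + 1 < i \<Longrightarrow> i \<le> n + 2 \<Longrightarrow> x \<in> carrier (G (n + 1)) \<Longrightarrow>
        d (n + 2) i (s (n + 1) j x) = s n j (d (n + 1) (i - 1) x)"

text \<open>The intersection with the carrier makes the degree-0 term all of \<open>G 0\<close>.\<close>

definition moore ::
    "(nat \<Rightarrow> ('a, 'b) monoid_scheme) \<Rightarrow> (nat \<Rightarrow> nat \<Rightarrow> 'a \<Rightarrow> 'a) \<Rightarrow> nat \<Rightarrow> 'a set"
  where "moore G d n = carrier (G n) \<inter> (\<Inter>i<n. kernel (G n) (G (n - 1)) (d n i))"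

text \<open>
  The elements of \<open>G n\<close> of the form \<open>s\<^sub>i y\<close>, for \<open>n > 0\<close>, and the subgroup they generate.
\<close>

definition degenerate_elements ::
    "(nat \<Rightarrow> ('a, 'b) monoid_scheme) \<Rightarrow> (nat \<Rightarrow> nat \<Rightarrow> 'a \<Rightarrow> 'a) \<Rightarrow> nat \<Rightarrow> 'a set"
  where "degenerate_elements G s n = (\<Union>i<n. s (n - 1) i ` carrier (G (n - 1)))"

definition degenerate_subgroup ::
    "(nat \<Rightarrow> ('a, 'b) monoid_scheme) \<Rightarrow> (nat \<Rightarrow> nat \<Rightarrow> 'a \<Rightarrow> 'a) \<Rightarrow> nat \<Rightarrow> 'a set"
  where "degenerate_subgroup G s n = generate (G n) (degenerate_elements G s n)"

text \<open>
  The string \<open>(i\<^sub>l, \<dots>, i\<^sub>1)\<close> is the strictly decreasing list with head \<open>i\<^sub>l\<close> and last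
  element \<open>i\<^sub>1\<close>; being strictly decreasing below \<open>n\<close> it has length at most \<open>n\<close>.
\<close>

definition index_strings :: "nat \<Rightarrow> nat list set"
  where "index_strings n = {\<alpha>. sorted_wrt (>) \<alpha> \<and> (\<forall>i\<in>set \<alpha>. i < n)}"

text \<open>
  \<open>string_less \<beta> \<alpha>\<close> is \<open>\<beta> < \<alpha>\<close>. Strings are compared starting from their smallest
  indices, hence the reversals; note that the smaller differing index belongs to the
  larger string.
\<close>

definition string_less :: "nat list \<Rightarrow> nat list \<Rightarrow> bool"
  where "string_less \<beta> \<alpha> \<longleftrightarrow>
    (\<exists>k. k < length \<alpha> \<and> k < length \<beta> \<and>
         take k (rev \<alpha>) = take k (rev \<beta>) \<and> rev \<alpha> ! k < rev \<beta> ! k) \<or>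
    (length \<beta> < length \<alpha> \<and> take (length \<beta>) (rev \<alpha>) = rev \<beta>)"

definition string_pairs :: "nat \<Rightarrow> (nat list \<times> nat list) set"
  where "string_pairs n =
    {(\<alpha>, \<beta>). \<alpha> \<in> index_strings n \<and> \<beta> \<in> index_strings n \<and> \<alpha> \<noteq> [] \<and> \<beta> \<noteq> [] \<and>
             set \<alpha> \<inter> set \<beta> = {} \<and> string_less \<beta> \<alpha>}"

text \<open>
  \<open>degeneracies s m \<alpha>\<close> is \<open>s\<^sub>\<alpha>\<close> with source \<open>G m\<close> and target \<open>G (m + length \<alpha>)\<close>.
\<close>

primrec degeneracies ::
    "(nat \<Rightarrow> nat \<Rightarrow> 'a \<Rightarrow> 'a) \<Rightarrow> nat \<Rightarrow> nat list \<Rightarrow> 'a \<Rightarrow> 'a"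
  where
    "degeneracies s m [] x = x"
  | "degeneracies s m (i # \<alpha>) x = s (m + length \<alpha>) i (degeneracies s m \<alpha> x)"

definition commutator :: "('a, 'b) monoid_scheme \<Rightarrow> 'a \<Rightarrow> 'a \<Rightarrow> 'a"
  where "commutator H a b = a \<otimes>\<^bsub>H\<^esub> b \<otimes>\<^bsub>H\<^esub> inv\<^bsub>H\<^esub> a \<otimes>\<^bsub>H\<^esub> inv\<^bsub>H\<^esub> b"

definition moore_proj_step ::
    "(nat \<Rightarrow> ('a, 'b) monoid_scheme) \<Rightarrow> (nat \<Rightarrow> nat \<Rightarrow> 'a \<Rightarrow> 'a) \<Rightarrow>
     (nat \<Rightarrow> nat \<Rightarrow> 'a \<Rightarrow> 'a) \<Rightarrow> nat \<Rightarrow> nat \<Rightarrow> 'a \<Rightarrow> 'a"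
  where "moore_proj_step G d s n j z = z \<otimes>\<^bsub>G n\<^esub> inv\<^bsub>G n\<^esub> (s (n - 1) j (d n j z))"

text \<open>\<open>fold\<close> applies the step with \<open>j = 0\<close> first.\<close>

definition moore_proj ::
    "(nat \<Rightarrow> ('a, 'b) monoid_scheme) \<Rightarrow> (nat \<Rightarrow> nat \<Rightarrow> 'a \<Rightarrow> 'a) \<Rightarrow>
     (nat \<Rightarrow> nat \<Rightarrow> 'a \<Rightarrow> 'a) \<Rightarrow> nat \<Rightarrow> 'a \<Rightarrow> 'a"
  where "moore_proj G d s n = fold (moore_proj_step G d s n) [0..<n]"

definition pairing ::
    "(nat \<Rightarrow> ('a, 'b) monoid_scheme) \<Rightarrow> (nat \<Rightarrow> nat \<Rightarrow> 'a \<Rightarrow> 'a) \<Rightarrow>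
     (nat \<Rightarrow> nat \<Rightarrow> 'a \<Rightarrow> 'a) \<Rightarrow> nat \<Rightarrow> nat list \<Rightarrow> nat list \<Rightarrow> 'a \<Rightarrow> 'a \<Rightarrow> 'a"
  where "pairing G d s n \<alpha> \<beta> x y =
    moore_proj G d s n
      (commutator (G n) (degeneracies s (n - length \<alpha>) \<alpha> x)
                        (degeneracies s (n - length \<beta>) \<beta> y))"

definition normal_closure :: "('a, 'b) monoid_scheme \<Rightarrow> 'a set \<Rightarrow> 'a set"
  where "normal_closure H S = \<Inter>{N. N \<lhd> H \<and> S \<subseteq> N}"

definition pairing_subgroup ::
    "(nat \<Rightarrow> ('a, 'b) monoid_scheme) \<Rightarrow> (nat \<Rightarrow> nat \<Rightarrow> 'a \<Rightarrow> 'a) \<Rightarrow>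
     (nat \<Rightarrow> nat \<Rightarrow> 'a \<Rightarrow> 'a) \<Rightarrow> nat \<Rightarrow> 'a set"
  where "pairing_subgroup G d s n =
    normal_closure (G n)
      {pairing G d s n \<alpha> \<beta> x y | \<alpha> \<beta> x y.
        (\<alpha>, \<beta>) \<in> string_pairs n \<and>
        x \<in> moore G d (n - length \<alpha>) \<and> y \<in> moore G d (n - length \<beta>)}"

end

theory Submission
  imports Defs
begin

text \<open>
  The values of the pairings lie in the normal subgroup \<open>NG\<^sub>n\<close>, so \<open>N\<^sub>n \<subseteq> NG\<^sub>n\<close> and only
  \<open>NG\<^sub>n \<inter> D\<^sub>n \<subseteq> N\<^sub>n\<close> has content. As \<open>p\<close> fixes \<open>NG\<^sub>n\<close> pointwise, it suffices that \<open>p\<close> maps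
  \<open>D\<^sub>n\<close> into \<open>N\<^sub>n\<close>.

  To follow the steps of \<open>p\<close>, let \<open>M\<^sub>k\<close> be the subgroup generated by \<open>N\<^sub>n\<close> and all
  \<open>s\<^sub>\<beta> y\<close> with \<open>y\<close> in the Moore complex and \<open>\<beta>\<close> a non-empty string of indices \<open>\<ge> k\<close>. Then
  \<open>D\<^sub>n \<subseteq> M\<^sub>0\<close>, because \<open>z = p\<^sub>k z \<cdot> s\<^sub>k d\<^sub>k z\<close> decomposes every element of \<open>G\<^sub>m\<close> into
  degeneracies of elements of the Moore complex; and \<open>M\<^sub>n = N\<^sub>n\<close>. It remains to see that
  \<open>p\<^sub>k\<close> maps \<open>M\<^sub>k\<close> into \<open>M\<^sub>k\<^sub>+\<^sub>1\<close>. A generator \<open>s\<^sub>\<beta> y\<close> of \<open>M\<^sub>k\<close> is either killed by \<open>p\<^sub>k\<close>,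
  when \<open>k\<close> occurs in \<open>\<beta>\<close>, or a generator of \<open>M\<^sub>k\<^sub>+\<^sub>1\<close> fixed by \<open>p\<^sub>k\<close>. Since \<open>p\<^sub>k\<close> is a crossed
  homomorphism, products are under control once the elements \<open>s\<^sub>k w\<close>, where \<open>w\<close> is killed by
  the faces \<open>d\<^sub>i\<close> with \<open>i < k\<close>, normalise \<open>M\<^sub>k\<^sub>+\<^sub>1\<close>.

  This is the point at which the pairings enter
  (\<open>conj_degeneracies_deg_filtration\<close>). It suffices to conjugate \<open>s\<^sub>\<beta> y\<close>, with all indices of
  \<open>\<beta>\<close> above \<open>k\<close>, by \<open>s\<^sub>\<alpha> x\<close>, where \<open>k\<close> is the least index of \<open>\<alpha>\<close>. If the strings share an
  index \<open>j\<close>, then both elements are values of \<open>s\<^sub>j\<close>, and so is the conjugate. Otherwise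
  \<open>(\<alpha>, \<beta>)\<close> is in \<open>P(n)\<close>, and the commutator \<open>c = [s\<^sub>\<alpha> x, s\<^sub>\<beta> y]\<close> satisfies \<open>p c \<in> N\<^sub>n\<close>. As
  \<open>c\<close> is killed by \<open>d\<^sub>0, \<dots>, d\<^sub>k\<close>, the passage from \<open>c\<close> to \<open>p c\<close> only splits off
  factors \<open>s\<^sub>i d\<^sub>i z\<close> with \<open>i > k\<close> that lie in \<open>M\<^sub>k\<^sub>+\<^sub>1\<close>, so \<open>c \<in> M\<^sub>k\<^sub>+\<^sub>1\<close>.
\<close>

section \<open>Conjugation and normal closures\<close>

lemma (in group) inv_cancel_left:
  "\<lbrakk>a \<in> carrier G; y \<in> carrier G\<rbrakk> \<Longrightarrow> inv a \<otimes> (a \<otimes> y) = y"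
  by (simp add: m_assoc[symmetric])

lemma (in group) conj_mult:
  "\<lbrakk>a \<in> carrier G; x \<in> carrier G; y \<in> carrier G\<rbrakk> \<Longrightarrow>
    a \<otimes> (x \<otimes> y) \<otimes> inv a = (a \<otimes> x \<otimes> inv a) \<otimes> (a \<otimes> y \<otimes> inv a)"
  by (simp add: m_assoc inv_cancel_left)


lemma normal_closure_minimal: "\<lbrakk>N \<lhd> H; S \<subseteq> N\<rbrakk> \<Longrightarrow> normal_closure H S \<subseteq> N"
  by (auto simp: normal_closure_def)

lemma normal_closure_incl: "x \<in> S \<Longrightarrow> x \<in> normal_closure H S"
  by (auto simp: normal_closure_def)

text \<open>
  If \<open>S\<close> had an element outside the carrier, no normal subgroup would contain \<open>S\<close>, and
  the intersection of the empty family would be \<open>UNIV\<close>.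
\<close>

lemma (in group) normal_closure_normal:
  assumes "S \<subseteq> carrier G"
  shows "normal_closure G S \<lhd> G"
  unfolding normal_inv_iff
proof (intro conjI ballI)
  show "subgroup (normal_closure G S) G"
    unfolding normal_closure_def
    using assms normal_self by (intro subgroups_Inter) (auto intro: normal_imp_subgroup)
  show "x \<otimes> h \<otimes> inv x \<in> normal_closure G S"
    if "x \<in> carrier G" "h \<in> normal_closure G S" for x h
    using that normal.inv_op_closed2 by (fastforce simp: normal_closure_def)
qed

section \<open>The simplicial identities as hom and rewrite rules\<close>

context simplicial_group
begin

interpretation gr: group "G n" for n
  by (rule is_group)

lemma face_group_hom: "i \<le> Suc n \<Longrightarrow> group_hom (G (Suc n)) (G n) (d (Suc n) i)"
  by (simp add: group_hom_def group_hom_axioms_def is_group face_hom)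

lemma degeneracy_group_hom: "i \<le> n \<Longrightarrow> group_hom (G n) (G (Suc n)) (s n i)"
  by (simp add: group_hom_def group_hom_axioms_def is_group degeneracy_hom)

lemma face_simps:
  assumes "i \<le> Suc n"
  shows "x \<in> carrier (G (Suc n)) \<Longrightarrow> d (Suc n) i x \<in> carrier (G n)"
    and "\<lbrakk>x \<in> carrier (G (Suc n)); y \<in> carrier (G (Suc n))\<rbrakk> \<Longrightarrow>
      d (Suc n) i (x \<otimes>\<^bsub>G (Suc n)\<^esub> y) = d (Suc n) i x \<otimes>\<^bsub>G n\<^esub> d (Suc n) i y"
    and "x \<in> carrier (G (Suc n)) \<Longrightarrow>
      d (Suc n) i (inv\<^bsub>G (Suc n)\<^esub> x) = inv\<^bsub>G n\<^esub> d (Suc n) i x"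
    and "d (Suc n) i \<one>\<^bsub>G (Suc n)\<^esub> = \<one>\<^bsub>G n\<^esub>"
proof -
  interpret h: group_hom "G (Suc n)" "G n" "d (Suc n) i"
    by (rule face_group_hom) fact
  show "x \<in> carrier (G (Suc n)) \<Longrightarrow> d (Suc n) i x \<in> carrier (G n)"
    "\<lbrakk>x \<in> carrier (G (Suc n)); y \<in> carrier (G (Suc n))\<rbrakk> \<Longrightarrow>
      d (Suc n) i (x \<otimes>\<^bsub>G (Suc n)\<^esub> y) = d (Suc n) i x \<otimes>\<^bsub>G n\<^esub> d (Suc n) i y"
    "x \<in> carrier (G (Suc n)) \<Longrightarrow>
      d (Suc n) i (inv\<^bsub>G (Suc n)\<^esub> x) = inv\<^bsub>G n\<^esub> d (Suc n) i x"
    "d (Suc n) i \<one>\<^bsub>G (Suc n)\<^esub> = \<one>\<^bsub>G n\<^esub>"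
    by simp_all
qed

lemma degeneracy_simps:
  assumes "i \<le> n"
  shows "x \<in> carrier (G n) \<Longrightarrow> s n i x \<in> carrier (G (Suc n))"
    and "\<lbrakk>x \<in> carrier (G n); y \<in> carrier (G n)\<rbrakk> \<Longrightarrow>
      s n i (x \<otimes>\<^bsub>G n\<^esub> y) = s n i x \<otimes>\<^bsub>G (Suc n)\<^esub> s n i y"
    and "x \<in> carrier (G n) \<Longrightarrow> s n i (inv\<^bsub>G n\<^esub> x) = inv\<^bsub>G (Suc n)\<^esub> s n i x"
    and "s n i \<one>\<^bsub>G n\<^esub> = \<one>\<^bsub>G (Suc n)\<^esub>"
proof -
  interpret h: group_hom "G n" "G (Suc n)" "s n i"
    by (rule degeneracy_group_hom) fact
  show "x \<in> carrier (G n) \<Longrightarrow> s n i x \<in> carrier (G (Suc n))"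
    "\<lbrakk>x \<in> carrier (G n); y \<in> carrier (G n)\<rbrakk> \<Longrightarrow>
      s n i (x \<otimes>\<^bsub>G n\<^esub> y) = s n i x \<otimes>\<^bsub>G (Suc n)\<^esub> s n i y"
    "x \<in> carrier (G n) \<Longrightarrow> s n i (inv\<^bsub>G n\<^esub> x) = inv\<^bsub>G (Suc n)\<^esub> s n i x"
    "s n i \<one>\<^bsub>G n\<^esub> = \<one>\<^bsub>G (Suc n)\<^esub>"
    by simp_all
qed

lemma face_face_Suc: "\<lbrakk>i < j; j \<le> Suc (Suc n); x \<in> carrier (G (Suc (Suc n)))\<rbrakk> \<Longrightarrow>
    d (Suc n) i (d (Suc (Suc n)) j x) = d (Suc n) (j - 1) (d (Suc (Suc n)) i x)"
  using face_face[of i j n x] by simp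

lemma degeneracy_degeneracy_Suc: "\<lbrakk>i \<le> j; j \<le> n; x \<in> carrier (G n)\<rbrakk> \<Longrightarrow>
    s (Suc n) i (s n j x) = s (Suc n) (Suc j) (s n i x)"
  using degeneracy_degeneracy[of i j n x] by simp

lemma face_degeneracy_less_Suc: "\<lbrakk>i < j; j \<le> Suc n; x \<in> carrier (G (Suc n))\<rbrakk> \<Longrightarrow>
    d (Suc (Suc n)) i (s (Suc n) j x) = s n (j - 1) (d (Suc n) i x)"
  using face_degeneracy_less[of i j n x] by simp

lemma face_degeneracy_same_Suc: "\<lbrakk>j \<le> n; x \<in> carrier (G n)\<rbrakk> \<Longrightarrow> d (Suc n) j (s n j x) = x"
  using face_degeneracy_same[of j n x] by simp

section \<open>Partial Moore complexes\<close>

text \<open>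
  These interpolate between \<open>G m\<close> (at \<open>k = 0\<close>) and the Moore complex term (at \<open>k \<ge> m\<close>).
  Capping the faces at \<open>m\<close> makes \<open>s\<^sub>\<alpha>\<close> preserve the partial Moore complexes of a
  fixed \<open>k\<close> without any condition relating \<open>k\<close> to the degree.
\<close>

definition partial_moore :: "nat \<Rightarrow> nat \<Rightarrow> 'a set"
  where "partial_moore k m =
    {x \<in> carrier (G m). \<forall>i < min k m. d m i x = \<one>\<^bsub>G (m - 1)\<^esub>}"

lemma partial_moore_carrier: "x \<in> partial_moore k m \<Longrightarrow> x \<in> carrier (G m)"
  by (simp add: partial_moore_def)

lemma partial_moore_face:
  "\<lbrakk>x \<in> partial_moore k (Suc m); i < k; i \<le> m\<rbrakk> \<Longrightarrow> d (Suc m) i x = \<one>\<^bsub>G m\<^esub>"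
  by (simp add: partial_moore_def)

lemma partial_moore_0: "partial_moore 0 m = carrier (G m)"
  by (simp add: partial_moore_def)

lemma moore_eq_partial_moore: "m \<le> k \<Longrightarrow> moore G d m = partial_moore k m"
  by (auto simp: moore_def partial_moore_def kernel_def)

lemma moore_subset_partial_moore: "moore G d m \<subseteq> partial_moore k m"
  by (auto simp: moore_def partial_moore_def kernel_def)

lemma partial_moore_normal: "partial_moore k m \<lhd> G m"
proof (cases m)
  case 0
  then show ?thesis
    using gr.normal_self[of 0] by (simp add: partial_moore_def)
next
  case (Suc m')
  show ?thesis
    unfolding gr.normal_inv_iff
  proof (intro conjI ballI)
    show "subgroup (partial_moore k m) (G m)"
      by (rule gr.subgroupI) (auto simp: partial_moore_def Suc face_simps)
    show "x \<otimes>\<^bsub>G m\<^esub> h \<otimes>\<^bsub>G m\<^esub> inv\<^bsub>G m\<^esub> x \<in> partial_moore k m"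
      if "x \<in> carrier (G m)" "h \<in> partial_moore k m" for x h
      using that by (auto simp: partial_moore_def Suc face_simps)
  qed
qed

lemma partial_moore_subgroup: "subgroup (partial_moore k m) (G m)"
  using partial_moore_normal by (simp add: gr.normal_inv_iff)

lemma partial_moore_conj:
  "\<lbrakk>x \<in> carrier (G m); y \<in> partial_moore k m\<rbrakk> \<Longrightarrow>
    x \<otimes>\<^bsub>G m\<^esub> y \<otimes>\<^bsub>G m\<^esub> inv\<^bsub>G m\<^esub> x \<in> partial_moore k m"
  using partial_moore_normal[of k m] by (simp add: gr.normal_inv_iff)

lemma degeneracy_partial_moore:
  assumes "k \<le> j" "j \<le> m" "x \<in> partial_moore k m"
  shows "s m j x \<in> partial_moore k (Suc m)"
proof -
  have x: "x \<in> carrier (G m)"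
    using assms(3) by (rule partial_moore_carrier)
  have "d (Suc m) i (s m j x) = \<one>\<^bsub>G m\<^esub>" if "i < k" for i
  proof -
    from that assms obtain m' where m: "m = Suc m'"
      by (cases m) auto
    have "d (Suc m) i (s m j x) = s m' (j - 1) (d m i x)"
      unfolding m using that assms x by (intro face_degeneracy_less_Suc) (auto simp: m)
    also have "d m i x = \<one>\<^bsub>G m'\<^esub>"
      using that assms by (auto simp: partial_moore_def m)
    also have "s m' (j - 1) \<one>\<^bsub>G m'\<^esub> = \<one>\<^bsub>G m\<^esub>"
      using assms by (auto simp: m degeneracy_simps)
    finally show ?thesis .
  qed
  then show ?thesis
    using assms x by (auto simp: partial_moore_def degeneracy_simps)
qed

lemma face_partial_moore:
  assumes "k \<le> j" "j \<le> Suc m" "x \<in> partial_moore k (Suc m)"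
  shows "d (Suc m) j x \<in> partial_moore k m"
proof -
  have x: "x \<in> carrier (G (Suc m))"
    using assms(3) by (rule partial_moore_carrier)
  have "d m i (d (Suc m) j x) = \<one>\<^bsub>G (m - 1)\<^esub>" if "i < min k m" for i
  proof -
    from that obtain m' where m: "m = Suc m'"
      by (cases m) auto
    have "d m i (d (Suc m) j x) = d m (j - 1) (d (Suc m) i x)"
      unfolding m using that assms x by (intro face_face_Suc) (auto simp: m)
    also have "d (Suc m) i x = \<one>\<^bsub>G m\<^esub>"
      using that assms by (auto simp: partial_moore_def)
    also have "d m (j - 1) \<one>\<^bsub>G m\<^esub> = \<one>\<^bsub>G (m - 1)\<^esub>"
      using assms by (auto simp: m face_simps)
    finally show ?thesis .
  qed
  then show ?thesis
    using assms x by (auto simp: partial_moore_def face_simps)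
qed

section \<open>The projection onto the Moore complex\<close>

lemma step_Suc:
  "moore_proj_step G d s (Suc m) j z =
    z \<otimes>\<^bsub>G (Suc m)\<^esub> inv\<^bsub>G (Suc m)\<^esub> s m j (d (Suc m) j z)"
  by (simp add: moore_proj_step_def)

lemma step_mult_degeneracy:
  assumes "j \<le> m" "z \<in> carrier (G (Suc m))"
  shows "z = moore_proj_step G d s (Suc m) j z \<otimes>\<^bsub>G (Suc m)\<^esub> s m j (d (Suc m) j z)"
  using assms by (simp add: step_Suc face_simps degeneracy_simps gr.m_assoc)

lemma step_id:
  assumes "j \<le> m" "z \<in> carrier (G (Suc m))" "d (Suc m) j z = \<one>\<^bsub>G m\<^esub>"
  shows "moore_proj_step G d s (Suc m) j z = z"
  using assms by (simp add: step_Suc degeneracy_simps)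

lemma step_partial_moore:
  assumes "k \<le> j" "j \<le> m" "z \<in> partial_moore k (Suc m)"
  shows "moore_proj_step G d s (Suc m) j z \<in> partial_moore k (Suc m)"
proof -
  interpret K: subgroup "partial_moore k (Suc m)" "G (Suc m)"
    by (rule partial_moore_subgroup)
  have "s m j (d (Suc m) j z) \<in> partial_moore k (Suc m)"
    using assms by (intro degeneracy_partial_moore face_partial_moore) auto
  then show ?thesis
    using assms by (simp add: step_Suc)
qed

lemma step_improves_partial_moore:
  assumes "k \<le> m" "z \<in> partial_moore k (Suc m)"
  shows "moore_proj_step G d s (Suc m) k z \<in> partial_moore (Suc k) (Suc m)"
proof -
  have z: "z \<in> carrier (G (Suc m))"
    using assms(2) by (rule partial_moore_carrier)
  have "moore_proj_step G d s (Suc m) k z \<in> partial_moore k (Suc m)"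
    using assms by (intro step_partial_moore) auto
  moreover have "d (Suc m) k (moore_proj_step G d s (Suc m) k z) = \<one>\<^bsub>G m\<^esub>"
    using assms(1) z by (simp add: step_Suc face_simps degeneracy_simps face_degeneracy_same_Suc)
  ultimately show ?thesis
    using assms(1) by (auto simp: partial_moore_def less_Suc_eq)
qed

lemma moore_proj_moore:
  assumes "z \<in> carrier (G (Suc m))"
  shows "moore_proj G d s (Suc m) z \<in> moore G d (Suc m)"
proof -
  have "fold (moore_proj_step G d s (Suc m)) [0..<k] z \<in> partial_moore k (Suc m)"
    if "k \<le> Suc m" for k
    using that
  proof (induction k)
    case 0
    then show ?case
      using assms by (simp add: partial_moore_0)
  next
    case (Suc k)
    then show ?case
      by (simp add: step_improves_partial_moore)
  qed
  from this[of "Suc m"] show ?thesis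
    by (simp add: moore_proj_def moore_eq_partial_moore[of "Suc m" "Suc m"])
qed

section \<open>Iterated degeneracies\<close>

lemma index_strings_Nil: "[] \<in> index_strings n"
  by (simp add: index_strings_def)

lemma index_strings_Cons:
  "i # \<alpha> \<in> index_strings (Suc n) \<longleftrightarrow> i \<le> n \<and> \<alpha> \<in> index_strings i"
  by (auto simp: index_strings_def)

lemma index_strings_mono: "m \<le> n \<Longrightarrow> index_strings m \<subseteq> index_strings n"
  by (auto simp: index_strings_def)

lemma index_strings_tail: "i # \<alpha> \<in> index_strings (Suc n) \<Longrightarrow> \<alpha> \<in> index_strings n"
  using index_strings_mono[of i n] by (auto simp: index_strings_Cons)

lemma length_index_strings:
  assumes "\<alpha> \<in> index_strings n"
  shows "length \<alpha> \<le> n"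
  using assms
proof (induction n arbitrary: \<alpha>)
  case 0
  then show ?case
    by (cases \<alpha>) (auto simp: index_strings_def)
next
  case (Suc n)
  then show ?case
    by (cases \<alpha>) (auto dest: index_strings_tail)
qed

lemma degeneracies_hom:
  assumes "\<alpha> \<in> index_strings (m + length \<alpha>)"
  shows "degeneracies s m \<alpha> \<in> hom (G m) (G (m + length \<alpha>))"
  using assms
proof (induction \<alpha>)
  case Nil
  then show ?case
    by (simp add: hom_def)
next
  case (Cons i \<alpha>)
  then have 1: "degeneracies s m \<alpha> \<in> hom (G m) (G (m + length \<alpha>))"
    by (auto dest: index_strings_tail)
  have 2: "s (m + length \<alpha>) i \<in> hom (G (m + length \<alpha>)) (G (Suc (m + length \<alpha>)))"
    using Cons.prems by (intro degeneracy_hom) (auto simp: index_strings_Cons)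
  from hom_compose[OF 1 2] show ?case
    by (simp add: o_def)
qed

lemma degeneracies_partial_moore:
  assumes "\<alpha> \<in> index_strings (m + length \<alpha>)" "\<forall>i\<in>set \<alpha>. k \<le> i" "x \<in> partial_moore k m"
  shows "degeneracies s m \<alpha> x \<in> partial_moore k (m + length \<alpha>)"
  using assms
proof (induction \<alpha>)
  case (Cons i \<alpha>)
  then have "degeneracies s m \<alpha> x \<in> partial_moore k (m + length \<alpha>)"
    by (auto dest: index_strings_tail)
  with Cons.prems show ?case
    by (auto simp: index_strings_Cons intro: degeneracy_partial_moore)
qed simp

text \<open>
  A surjection that identifies \<open>j\<close> and \<open>j + 1\<close> factors through the one that identifies
  only these; so any index of a string can be applied last.
\<close>

lemma degeneracies_pull_out:
  assumes "\<alpha> \<in> index_strings (m + length \<alpha>)" "\<forall>i\<in>set \<alpha>. k \<le> i" "j \<in> set \<alpha>"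
    and "x \<in> partial_moore k m"
  shows "\<exists>x' \<in> partial_moore k (m + length \<alpha> - 1).
           degeneracies s m \<alpha> x = s (m + length \<alpha> - 1) j x'"
  using assms
proof (induction \<alpha>)
  case (Cons i \<alpha>)
  have \<alpha>: "\<alpha> \<in> index_strings (m + length \<alpha>)" "\<forall>i\<in>set \<alpha>. k \<le> i"
    using Cons.prems by (auto dest: index_strings_tail)
  show ?case
  proof (cases "j = i")
    case True
    then show ?thesis
      using degeneracies_partial_moore[OF \<alpha> Cons.prems(4)] by auto
  next
    case False
    then have j: "j \<in> set \<alpha>"
      using Cons.prems by auto
    then obtain t where t: "m + length \<alpha> = Suc t"
      by (cases \<alpha>) auto
    obtain y where y: "y \<in> partial_moore k t" "degeneracies s m \<alpha> x = s t j y"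
      using Cons.IH[OF \<alpha> j Cons.prems(4)] by (auto simp: t)
    have "j < i"
      using Cons.prems(1) j by (auto simp: index_strings_Cons index_strings_def)
    moreover have "i \<le> Suc t" "k \<le> j"
      using Cons.prems(1,2) \<alpha>(2) j by (auto simp: index_strings_Cons t)
    ultimately obtain i' where i': "i = Suc i'" "j \<le> i'" "i' \<le> t" "k \<le> i'"
      by (cases i) auto
    then have "s (Suc t) i (s t j y) = s (Suc t) j (s t i' y)"
      using y(1) by (simp add: degeneracy_degeneracy_Suc partial_moore_carrier)
    moreover have "s t i' y \<in> partial_moore k (Suc t)"
      using i' y(1) by (intro degeneracy_partial_moore)
    ultimately show ?thesis
      using y(2) by (auto simp: t)
  qed
qed simp

lemma degeneracies_append_least:
  assumes "\<gamma> \<in> index_strings (m + length \<gamma>)" "\<forall>i\<in>set \<gamma>. k \<le> i"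
    and "k \<le> m" "x \<in> carrier (G m)"
  shows "s (m + length \<gamma>) k (degeneracies s m \<gamma> x) = degeneracies s m (map Suc \<gamma> @ [k]) x"
  using assms
proof (induction \<gamma>)
  case (Cons i \<gamma>)
  have \<gamma>: "\<gamma> \<in> index_strings (m + length \<gamma>)" "\<forall>i\<in>set \<gamma>. k \<le> i"
    using Cons.prems by (auto dest: index_strings_tail)
  have i: "k \<le> i" "i \<le> m + length \<gamma>"
    using Cons.prems by (auto simp: index_strings_Cons)
  have "degeneracies s m \<gamma> x \<in> carrier (G (m + length \<gamma>))"
    using degeneracies_hom[OF \<gamma>(1)] Cons.prems(4) by (rule hom_in_carrier)
  with i have "s (Suc (m + length \<gamma>)) k (s (m + length \<gamma>) i (degeneracies s m \<gamma> x)) =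
      s (Suc (m + length \<gamma>)) (Suc i) (s (m + length \<gamma>) k (degeneracies s m \<gamma> x))"
    by (rule degeneracy_degeneracy_Suc)
  then show ?case
    using Cons.IH[OF \<gamma> Cons.prems(3,4)] by simp
qed simp

text \<open>
  The source of \<open>s\<^sub>\<alpha>\<close> then has degree at least \<open>k\<close>, so that \<open>s\<^sub>k\<close> is defined on it and
  can be applied before \<open>s\<^sub>\<alpha>\<close>.
\<close>

lemma length_index_strings_ge:
  assumes "\<alpha> \<in> index_strings n" "\<forall>i\<in>set \<alpha>. k \<le> i" "k \<le> n"
  shows "k + length \<alpha> \<le> n"
proof -
  have "sorted_wrt (>) \<alpha>" "set \<alpha> \<subseteq> {k..<n}"
    using assms by (auto simp: index_strings_def)
  then have "distinct \<alpha>"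
    by (induction \<alpha>) auto
  then have "length \<alpha> = card (set \<alpha>)"
    by (simp add: distinct_card)
  also have "\<dots> \<le> card {k..<n}"
    using \<open>set \<alpha> \<subseteq> {k..<n}\<close> by (intro card_mono) auto
  finally show ?thesis
    using assms(3) by simp
qed

section \<open>Generation by degeneracies of Moore complex elements\<close>

definition moore_images :: "nat \<Rightarrow> nat \<Rightarrow> 'a set"
  where "moore_images k n = {degeneracies s (n - length \<alpha>) \<alpha> x | \<alpha> x.
    \<alpha> \<in> index_strings n \<and> (\<forall>i\<in>set \<alpha>. k \<le> i) \<and> x \<in> moore G d (n - length \<alpha>)}"

definition degenerate_moore_images :: "nat \<Rightarrow> nat \<Rightarrow> 'a set"
  where "degenerate_moore_images k n = {degeneracies s (n - length \<alpha>) \<alpha> x | \<alpha> x.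
    \<alpha> \<in> index_strings n \<and> \<alpha> \<noteq> [] \<and> (\<forall>i\<in>set \<alpha>. k \<le> i) \<and> x \<in> moore G d (n - length \<alpha>)}"

lemma degeneracies_moore:
  assumes "\<alpha> \<in> index_strings n" "\<forall>i\<in>set \<alpha>. k \<le> i" "x \<in> moore G d (n - length \<alpha>)"
  shows "degeneracies s (n - length \<alpha>) \<alpha> x \<in> partial_moore k n"
  using degeneracies_partial_moore[of \<alpha> "n - length \<alpha>" k x] assms
    length_index_strings[OF assms(1)] moore_subset_partial_moore[of "n - length \<alpha>" k]
  by auto

lemma moore_images_carrier: "moore_images k n \<subseteq> carrier (G n)"
  by (auto simp: moore_images_def dest: degeneracies_moore intro: partial_moore_carrier)

lemma degenerate_moore_images_carrier: "degenerate_moore_images k n \<subseteq> carrier (G n)"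
  by (auto simp: degenerate_moore_images_def dest: degeneracies_moore
      intro: partial_moore_carrier)

lemma degenerate_moore_images_antimono:
  "k \<le> l \<Longrightarrow> degenerate_moore_images l n \<subseteq> degenerate_moore_images k n"
  unfolding degenerate_moore_images_def by fastforce

lemma moore_images_antimono: "k \<le> l \<Longrightarrow> moore_images l n \<subseteq> moore_images k n"
  unfolding moore_images_def by fastforce

text \<open>
  By \<open>s\<^sub>k s\<^sub>i = s\<^sub>i\<^sub>+\<^sub>1 s\<^sub>k\<close> for \<open>k \<le> i\<close>, applying \<open>s\<^sub>k\<close> last is the same as applying it
  first and shifting all the other indices. So \<open>s\<^sub>k s\<^sub>\<gamma>\<close> belongs to a string whose least
  index is \<open>k\<close>, and such a string exceeds every non-empty string of indices \<open>> k\<close>.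
\<close>

lemma shifted_string:
  assumes "\<gamma> \<in> index_strings n" "\<forall>i\<in>set \<gamma>. k \<le> i" "k \<le> n"
    and "x \<in> moore G d (n - length \<gamma>)"
  shows "map Suc \<gamma> @ [k] \<in> index_strings (Suc n)"
    and "s n k (degeneracies s (n - length \<gamma>) \<gamma> x) =
      degeneracies s (Suc n - length (map Suc \<gamma> @ [k])) (map Suc \<gamma> @ [k]) x"
proof -
  show "map Suc \<gamma> @ [k] \<in> index_strings (Suc n)"
    using assms
    by (auto simp: index_strings_def sorted_wrt_append sorted_wrt_map less_Suc_eq_le Suc_le_eq)
  show "s n k (degeneracies s (n - length \<gamma>) \<gamma> x) =
      degeneracies s (Suc n - length (map Suc \<gamma> @ [k])) (map Suc \<gamma> @ [k]) x"
    using degeneracies_append_least[of \<gamma> "n - length \<gamma>" k x] assms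
      length_index_strings_ge[OF assms(1-3)] by (simp add: moore_def)
qed

lemma degeneracy_moore_images:
  assumes "k \<le> m"
  shows "s m k ` moore_images k m \<subseteq> degenerate_moore_images k (Suc m)"
proof
  fix z assume "z \<in> s m k ` moore_images k m"
  then obtain \<gamma> x where \<gamma>: "\<gamma> \<in> index_strings m" "\<forall>i\<in>set \<gamma>. k \<le> i"
      "x \<in> moore G d (m - length \<gamma>)" and z: "z = s m k (degeneracies s (m - length \<gamma>) \<gamma> x)"
    by (auto simp: moore_images_def)
  let ?\<alpha> = "map Suc \<gamma> @ [k]"
  have "?\<alpha> \<in> index_strings (Suc m)" "z = degeneracies s (Suc m - length ?\<alpha>) ?\<alpha> x"
    using shifted_string[OF \<gamma>(1,2) assms \<gamma>(3)] z by auto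
  moreover have "\<forall>i\<in>set ?\<alpha>. k \<le> i" "x \<in> moore G d (Suc m - length ?\<alpha>)"
    using \<gamma> by (auto intro: le_SucI)
  ultimately show "z \<in> degenerate_moore_images k (Suc m)"
    unfolding degenerate_moore_images_def by blast
qed

text \<open>
  Iterating \<open>z = p\<^sub>k z \<cdot> s\<^sub>k d\<^sub>k z\<close>: the first factor lies in the next partial Moore
  complex, the second comes from one degree lower. Both raising \<open>k\<close> and lowering \<open>m\<close>
  decrease \<open>2 m - k\<close>.
\<close>

lemma partial_moore_generated:
  "x \<in> partial_moore k m \<Longrightarrow> x \<in> generate (G m) (moore_images k m)"
proof (induction "2 * m - k" arbitrary: m k x rule: less_induct)
  case less
  show ?case
  proof (cases "m \<le> k")
    case True
    then have "x \<in> moore_images k m"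
      using less.prems index_strings_Nil
      by (force simp: moore_images_def moore_eq_partial_moore[of m k])
    then show ?thesis
      by (rule generate.incl)
  next
    case False
    then obtain m' where m: "m = Suc m'" and k: "k \<le> m'"
      by (cases m) auto
    interpret h: group_hom "G m'" "G m" "s m' k"
      unfolding m using k by (rule degeneracy_group_hom)
    let ?p = "moore_proj_step G d s m k x"
    have x: "x \<in> carrier (G m)"
      using less.prems by (rule partial_moore_carrier)
    have "?p \<in> partial_moore (Suc k) m"
      using less.prems k step_improves_partial_moore by (simp add: m)
    with False have "?p \<in> generate (G m) (moore_images (Suc k) m)"
      by (intro less.hyps) auto
    moreover have "generate (G m) (moore_images (Suc k) m) \<subseteq> generate (G m) (moore_images k m)"
      by (intro gr.mono_generate moore_images_antimono) simp
    ultimately have p: "?p \<in> generate (G m) (moore_images k m)"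
      by blast
    have "d m k x \<in> partial_moore k m'"
      using less.prems k face_partial_moore[of k k m' x] by (simp add: m)
    with False have "d m k x \<in> generate (G m') (moore_images k m')"
      by (intro less.hyps) (auto simp: m)
    then have "s m' k (d m k x) \<in> generate (G m) (s m' k ` moore_images k m')"
      using h.generate_img[OF moore_images_carrier] by blast
    moreover have "s m' k ` moore_images k m' \<subseteq> moore_images k m"
      using degeneracy_moore_images[OF k]
      by (force simp: m moore_images_def degenerate_moore_images_def)
    ultimately have "s m' k (d m k x) \<in> generate (G m) (moore_images k m)"
      using gr.mono_generate by blast
    with p have "?p \<otimes>\<^bsub>G m\<^esub> s m' k (d m k x) \<in> generate (G m) (moore_images k m)"
      by (rule generate.eng)
    then show ?thesis
      using step_mult_degeneracy[of k m' x] k x by (simp add: m)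
  qed
qed

lemma degeneracy_least_generated:
  assumes "k \<le> m" "x \<in> partial_moore k m"
  shows "s m k x \<in> generate (G (Suc m)) (degenerate_moore_images k (Suc m))"
proof -
  interpret h: group_hom "G m" "G (Suc m)" "s m k"
    using assms(1) by (rule degeneracy_group_hom)
  have "s m k x \<in> generate (G (Suc m)) (s m k ` moore_images k m)"
    using partial_moore_generated[OF assms(2)] h.generate_img[OF moore_images_carrier]
    by blast
  then show ?thesis
    using gr.mono_generate[OF degeneracy_moore_images[OF assms(1)]] by blast
qed

text \<open>
  In \<open>s\<^sub>j x = s\<^sub>j p\<^sub>k x \<cdot> s\<^sub>j s\<^sub>k d\<^sub>k x\<close> the second factor equals \<open>s\<^sub>k s\<^sub>j\<^sub>-\<^sub>1 d\<^sub>k x\<close>,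
  which reduces it to the preceding lemma.
\<close>

lemma degeneracy_generated:
  assumes "k \<le> j" "j \<le> m" "x \<in> partial_moore k m"
  shows "s m j x \<in> generate (G (Suc m)) (degenerate_moore_images k (Suc m))"
  using assms
proof (induction k arbitrary: x rule: inc_induct)
  case base
  then show ?case
    by (intro degeneracy_least_generated)
next
  case (step k)
  then obtain m' where m: "m = Suc m'"
    by (cases m) auto
  obtain j' where j: "j = Suc j'"
    using step by (cases j) auto
  have kj: "k \<le> j'" "j' \<le> m'"
    using step by (auto simp: m j)
  have x: "x \<in> carrier (G m)"
    using step.prems by (auto intro: partial_moore_carrier)
  let ?p = "moore_proj_step G d s m k x" and ?y = "d m k x"
  have p: "?p \<in> partial_moore (Suc k) m"
    using step_improves_partial_moore[of k m' x] step.prems kj by (simp add: m)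
  then have 1: "s m j ?p \<in> generate (G (Suc m)) (degenerate_moore_images k (Suc m))"
    using step.IH[of ?p] step.prems
      gr.mono_generate[OF degenerate_moore_images_antimono[of k "Suc k" "Suc m"], of "Suc m"]
    by auto
  have y: "?y \<in> partial_moore k m'"
    using face_partial_moore[of k k m' x] step.prems kj by (simp add: m)
  have "s m' j' ?y \<in> partial_moore k m"
    using degeneracy_partial_moore[OF kj y] by (simp add: m)
  then have 2: "s m k (s m' j' ?y) \<in> generate (G (Suc m)) (degenerate_moore_images k (Suc m))"
    using kj by (intro degeneracy_least_generated) (auto simp: m)
  have "s m k (s m' j' ?y) = s m j (s m' k ?y)"
    unfolding m j using kj y
    by (intro degeneracy_degeneracy_Suc) (auto simp: m intro: partial_moore_carrier)
  moreover have "s m j x = s m j ?p \<otimes>\<^bsub>G (Suc m)\<^esub> s m j (s m' k ?y)"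
  proof -
    have "s m' k ?y \<in> carrier (G m)"
      using degeneracy_simps(1)[of k m' ?y] y kj by (simp add: m partial_moore_carrier)
    then have "s m j (?p \<otimes>\<^bsub>G m\<^esub> s m' k ?y) = s m j ?p \<otimes>\<^bsub>G (Suc m)\<^esub> s m j (s m' k ?y)"
      using p step.prems by (intro degeneracy_simps) (auto intro: partial_moore_carrier)
    then show ?thesis
      using step_mult_degeneracy[of k m' x] x kj by (simp add: m)
  qed
  ultimately show ?case
    using generate.eng[OF 1 2] by simp
qed

section \<open>The subgroup generated by the pairings\<close>

lemma pairing_moore:
  assumes "(\<alpha>, \<beta>) \<in> string_pairs (Suc m)"
    and "x \<in> moore G d (Suc m - length \<alpha>)" "y \<in> moore G d (Suc m - length \<beta>)"
  shows "pairing G d s (Suc m) \<alpha> \<beta> x y \<in> moore G d (Suc m)"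
proof -
  have "degeneracies s (Suc m - length \<alpha>) \<alpha> x \<in> partial_moore 0 (Suc m)"
    "degeneracies s (Suc m - length \<beta>) \<beta> y \<in> partial_moore 0 (Suc m)"
    using assms by (auto simp: string_pairs_def intro!: degeneracies_moore)
  then show ?thesis
    unfolding pairing_def
    by (intro moore_proj_moore) (simp add: commutator_def partial_moore_0)
qed

lemma moore_normal: "moore G d n \<lhd> G n"
  using partial_moore_normal[of n n] by (simp add: moore_eq_partial_moore[of n n])

lemma pairing_subgroup_moore: "pairing_subgroup G d s (Suc m) \<subseteq> moore G d (Suc m)"
  unfolding pairing_subgroup_def
  by (rule normal_closure_minimal[OF moore_normal]) (auto intro: pairing_moore)

lemma pairing_subgroup_normal: "pairing_subgroup G d s (Suc m) \<lhd> G (Suc m)"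
  unfolding pairing_subgroup_def
  by (rule gr.normal_closure_normal)
     (auto dest: pairing_moore simp: moore_def)

lemma pairing_in_pairing_subgroup:
  assumes "(\<alpha>, \<beta>) \<in> string_pairs n"
    and "x \<in> moore G d (n - length \<alpha>)" "y \<in> moore G d (n - length \<beta>)"
  shows "pairing G d s n \<alpha> \<beta> x y \<in> pairing_subgroup G d s n"
  unfolding pairing_subgroup_def using assms by (intro normal_closure_incl) blast

text \<open>
  This is the filtration of \<open>D\<^sub>n N\<^sub>n\<close> that the steps \<open>p\<^sub>0, \<dots>, p\<^sub>n\<^sub>-\<^sub>1\<close> descend; the
  group at \<open>k = n\<close> is \<open>N\<^sub>n\<close>.
\<close>

definition deg_filtration :: "nat \<Rightarrow> nat \<Rightarrow> 'a set"
  where "deg_filtration k n =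
    generate (G n) (degenerate_moore_images k n \<union> pairing_subgroup G d s n)"

lemma deg_filtration_gens_carrier:
  "degenerate_moore_images k (Suc m) \<union> pairing_subgroup G d s (Suc m) \<subseteq> carrier (G (Suc m))"
  using degenerate_moore_images_carrier pairing_subgroup_moore by (fastforce simp: moore_def)

lemma deg_filtration_subgroup: "subgroup (deg_filtration k (Suc m)) (G (Suc m))"
  unfolding deg_filtration_def
  by (rule gr.generate_is_subgroup[OF deg_filtration_gens_carrier])

lemma pairing_subgroup_deg_filtration: "pairing_subgroup G d s n \<subseteq> deg_filtration k n"
  by (auto simp: deg_filtration_def intro: generate.incl)

lemma degenerate_moore_images_deg_filtration: "degenerate_moore_images k n \<subseteq> deg_filtration k n"
  by (auto simp: deg_filtration_def intro: generate.incl)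

lemma degeneracy_deg_filtration:
  assumes "k \<le> j" "j \<le> m" "x \<in> partial_moore k m"
  shows "s m j x \<in> deg_filtration k (Suc m)"
  using degeneracy_generated[OF assms]
    gr.mono_generate[of "degenerate_moore_images k (Suc m)"
      "degenerate_moore_images k (Suc m) \<union> pairing_subgroup G d s (Suc m)" "Suc m"]
  by (auto simp: deg_filtration_def)

lemma deg_filtration_top: "deg_filtration (Suc m) (Suc m) = pairing_subgroup G d s (Suc m)"
proof -
  have "degenerate_moore_images (Suc m) (Suc m) = {}"
  proof -
    have "\<alpha> = []" if "\<alpha> \<in> index_strings (Suc m)" "\<forall>i\<in>set \<alpha>. Suc m \<le> i" for \<alpha>
      using that by (cases \<alpha>) (auto simp: index_strings_def)
    then show ?thesis
      unfolding degenerate_moore_images_def by blast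
  qed
  moreover have "subgroup (pairing_subgroup G d s (Suc m)) (G (Suc m))"
    using pairing_subgroup_normal by (rule normal_imp_subgroup)
  ultimately show ?thesis
    unfolding deg_filtration_def using gr.generate_subgroup_incl generate.incl by fastforce
qed

lemma degenerate_subgroup_deg_filtration:
  "degenerate_subgroup G s (Suc m) \<subseteq> deg_filtration 0 (Suc m)"
  unfolding degenerate_subgroup_def
proof (rule gr.generate_subgroup_incl[OF _ deg_filtration_subgroup])
  show "degenerate_elements G s (Suc m) \<subseteq> deg_filtration 0 (Suc m)"
    by (auto simp: degenerate_elements_def less_Suc_eq_le partial_moore_0
        intro!: degeneracy_deg_filtration)
qed

text \<open>
  On the partial Moore complex of index \<open>k\<close> each step of \<open>p\<close> changes its argument only
  by \<open>s\<^sub>i d\<^sub>i z\<close>, which is trivial for \<open>i < k\<close> and lies in the filtration for \<open>i \<ge> k\<close>.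
  So \<open>p z\<close> and \<open>z\<close> agree modulo the filtration group.
\<close>

lemma deg_filtration_if_moore_proj:
  assumes "z \<in> partial_moore k (Suc m)"
    and "moore_proj G d s (Suc m) z \<in> deg_filtration k (Suc m)"
  shows "z \<in> deg_filtration k (Suc m)"
proof -
  interpret M: subgroup "deg_filtration k (Suc m)" "G (Suc m)"
    by (rule deg_filtration_subgroup)
  have "z \<in> deg_filtration k (Suc m)"
    if "z \<in> partial_moore k (Suc m)" "set is \<subseteq> {..m}"
      "fold (moore_proj_step G d s (Suc m)) is z \<in> deg_filtration k (Suc m)" for "is" z
    using that
  proof (induction "is" arbitrary: z)
    case (Cons i "is")
    have z: "z \<in> carrier (G (Suc m))"
      using Cons.prems(1) by (rule partial_moore_carrier)
    let ?p = "moore_proj_step G d s (Suc m) i z"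
    show ?case
    proof (cases "i < k")
      case True
      then have "?p = z"
        using Cons.prems z by (intro step_id) (auto simp: partial_moore_def)
      then show ?thesis
        using Cons by auto
    next
      case False
      then have i: "k \<le> i" "i \<le> m"
        using Cons.prems by auto
      have "?p \<in> deg_filtration k (Suc m)"
        using Cons.prems i by (intro Cons.IH[OF step_partial_moore]) auto
      moreover have "s m i (d (Suc m) i z) \<in> deg_filtration k (Suc m)"
        using i Cons.prems by (intro degeneracy_deg_filtration face_partial_moore) auto
      ultimately have "?p \<otimes>\<^bsub>G (Suc m)\<^esub> s m i (d (Suc m) i z) \<in> deg_filtration k (Suc m)"
        by simp
      then show ?thesis
        using step_mult_degeneracy[OF i(2) z] by simp
    qed
  qed simp
  moreover have "set [0..<Suc m] \<subseteq> {..m}"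
    by auto
  ultimately show ?thesis
    using assms unfolding moore_proj_def by blast
qed

text \<open>
  The heart of the proof. A common index of the two strings can be pulled out of both, so
  the conjugate is then degenerate along it. For disjoint strings the pair is admissible,
  the least index \<open>k\<close> of the first being below all indices of the second, and the
  commutator is controlled by its image under \<open>p\<close>, which is a value of the pairing.
\<close>

lemma conj_degeneracies_deg_filtration:
  assumes \<gamma>: "\<gamma> \<in> index_strings m" "\<forall>i\<in>set \<gamma>. k \<le> i" "k \<le> m"
    and x: "x \<in> moore G d (m - length \<gamma>)"
    and \<beta>: "\<beta> \<in> index_strings (Suc m)" "\<forall>i\<in>set \<beta>. Suc k \<le> i" "\<beta> \<noteq> []"
    and y: "y \<in> moore G d (Suc m - length \<beta>)"
    and a: "a = s m k (degeneracies s (m - length \<gamma>) \<gamma> x)"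
    and b: "b = degeneracies s (Suc m - length \<beta>) \<beta> y"
  shows "a \<otimes>\<^bsub>G (Suc m)\<^esub> b \<otimes>\<^bsub>G (Suc m)\<^esub> inv\<^bsub>G (Suc m)\<^esub> a \<in> deg_filtration (Suc k) (Suc m)"
proof -
  define \<alpha> where "\<alpha> = map Suc \<gamma> @ [k]"
  have \<alpha>: "\<alpha> \<in> index_strings (Suc m)" "a = degeneracies s (Suc m - length \<alpha>) \<alpha> x"
    using shifted_string[OF \<gamma> x] by (auto simp: \<alpha>_def a)
  have \<alpha>k: "\<forall>i\<in>set \<alpha>. k \<le> i" "rev \<alpha> ! 0 = k" "\<alpha> \<noteq> []" and x': "x \<in> moore G d (Suc m - length \<alpha>)"
    using \<gamma> x by (auto simp: \<alpha>_def intro: le_SucI)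
  have len: "length \<alpha> \<le> Suc m" "length \<beta> \<le> Suc m"
    using \<alpha>(1) \<beta>(1) by (auto dest: length_index_strings)
  have bK: "b \<in> partial_moore (Suc k) (Suc m)"
    unfolding b using \<beta> y by (intro degeneracies_moore)
  have aG: "a \<in> carrier (G (Suc m))"
    using degeneracies_moore[OF \<alpha>(1) \<alpha>k(1) x'] by (simp add: \<alpha>(2) partial_moore_carrier)
  have bG: "b \<in> carrier (G (Suc m))"
    using bK by (rule partial_moore_carrier)
  interpret M: subgroup "deg_filtration (Suc k) (Suc m)" "G (Suc m)"
    by (rule deg_filtration_subgroup)
  show ?thesis
  proof (cases "set \<alpha> \<inter> set \<beta> = {}")
    case False
    then obtain j where j: "j \<in> set \<alpha>" "j \<in> set \<beta>"
      by auto
    obtain u where u: "u \<in> partial_moore k m" "a = s m j u"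
      using degeneracies_pull_out[of \<alpha> "Suc m - length \<alpha>" k j x] \<alpha> \<alpha>k(1) j(1) x' len
        moore_subset_partial_moore by fastforce
    obtain v where v: "v \<in> partial_moore (Suc k) m" "b = s m j v"
      using degeneracies_pull_out[of \<beta> "Suc m - length \<beta>" "Suc k" j y] \<beta> j(2) y len b
        moore_subset_partial_moore by fastforce
    have jm: "Suc k \<le> j" "j \<le> m"
      using \<beta> j(2) by (auto simp: index_strings_def)
    have uv: "u \<in> carrier (G m)" "v \<in> carrier (G m)"
      using u v by (auto intro: partial_moore_carrier)
    have "s m j (u \<otimes>\<^bsub>G m\<^esub> v \<otimes>\<^bsub>G m\<^esub> inv\<^bsub>G m\<^esub> u) \<in> deg_filtration (Suc k) (Suc m)"
      using jm uv v by (intro degeneracy_deg_filtration partial_moore_conj)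
    then show ?thesis
      using jm uv by (simp add: u v degeneracy_simps)
  next
    case True
    have "rev \<beta> ! 0 \<in> set \<beta>"
      using \<beta>(3) by (metis length_greater_0_conv nth_mem rev_is_Nil_conv set_rev)
    then have "rev \<alpha> ! 0 < rev \<beta> ! 0"
      using \<beta>(2) \<alpha>k(2) by auto
    then have "string_less \<beta> \<alpha>"
      unfolding string_less_def using \<alpha>k(3) \<beta>(3) by (intro disjI1 exI[of _ 0]) auto
    with True have "(\<alpha>, \<beta>) \<in> string_pairs (Suc m)"
      using \<alpha>(1) \<alpha>k(3) \<beta> by (simp add: string_pairs_def)
    then have "pairing G d s (Suc m) \<alpha> \<beta> x y \<in> pairing_subgroup G d s (Suc m)"
      using x' y by (rule pairing_in_pairing_subgroup)
    then have p: "moore_proj G d s (Suc m) (commutator (G (Suc m)) a b)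
        \<in> deg_filtration (Suc k) (Suc m)"
      using pairing_subgroup_deg_filtration by (auto simp: pairing_def \<alpha>(2) b)
    interpret K: subgroup "partial_moore (Suc k) (Suc m)" "G (Suc m)"
      by (rule partial_moore_subgroup)
    have "commutator (G (Suc m)) a b \<in> partial_moore (Suc k) (Suc m)"
      using partial_moore_conj[OF aG bK] bK by (simp add: commutator_def)
    then have "commutator (G (Suc m)) a b \<in> deg_filtration (Suc k) (Suc m)"
      using p by (rule deg_filtration_if_moore_proj)
    moreover have "b \<in> deg_filtration (Suc k) (Suc m)"
      using \<beta> y degenerate_moore_images_deg_filtration
      by (force simp: degenerate_moore_images_def b)
    ultimately have "commutator (G (Suc m)) a b \<otimes>\<^bsub>G (Suc m)\<^esub> b \<in> deg_filtration (Suc k) (Suc m)"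
      by simp
    then show ?thesis
      using aG bG by (simp add: commutator_def gr.m_assoc)
  qed
qed

text \<open>
  Conjugation by a product is iterated conjugation, and conjugation is a homomorphism; so
  generators suffice for the conjugating and for the conjugated element.
\<close>

lemma degeneracy_normalizes_deg_filtration:
  assumes k: "k \<le> m" and w: "w \<in> partial_moore k m"
    and c: "c \<in> deg_filtration (Suc k) (Suc m)"
  shows "s m k w \<otimes>\<^bsub>G (Suc m)\<^esub> c \<otimes>\<^bsub>G (Suc m)\<^esub> inv\<^bsub>G (Suc m)\<^esub> s m k w
    \<in> deg_filtration (Suc k) (Suc m)"
proof -
  let ?H = "G (Suc m)" and ?M = "deg_filtration (Suc k) (Suc m)"
  let ?conj = "\<lambda>a b. a \<otimes>\<^bsub>?H\<^esub> b \<otimes>\<^bsub>?H\<^esub> inv\<^bsub>?H\<^esub> a"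
  interpret M: subgroup ?M ?H
    by (rule deg_filtration_subgroup)
  interpret N: normal "pairing_subgroup G d s (Suc m)" ?H
    by (rule pairing_subgroup_normal)
  have gen: "?conj (s m k u) c \<in> ?M"
    if u: "u \<in> moore_images k m" and c: "c \<in> ?M" for u c
  proof -
    obtain \<gamma> x where \<gamma>: "\<gamma> \<in> index_strings m" "\<forall>i\<in>set \<gamma>. k \<le> i"
        "x \<in> moore G d (m - length \<gamma>)" and u': "u = degeneracies s (m - length \<gamma>) \<gamma> x"
      using u by (auto simp: moore_images_def)
    have "u \<in> carrier (G m)"
      using u moore_images_carrier by blast
    then have aG: "s m k u \<in> carrier ?H"
      using k by (simp add: degeneracy_simps)
    have base: "?conj (s m k u) h \<in> ?M"
      if "h \<in> degenerate_moore_images (Suc k) (Suc m) \<union> pairing_subgroup G d s (Suc m)" for h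
      using that
    proof
      assume "h \<in> degenerate_moore_images (Suc k) (Suc m)"
      then obtain \<beta> y where \<beta>: "\<beta> \<in> index_strings (Suc m)" "\<forall>i\<in>set \<beta>. Suc k \<le> i" "\<beta> \<noteq> []"
          "y \<in> moore G d (Suc m - length \<beta>)" and h: "h = degeneracies s (Suc m - length \<beta>) \<beta> y"
        unfolding degenerate_moore_images_def by blast
      have "s m k u = s m k (degeneracies s (m - length \<gamma>) \<gamma> x)"
        by (simp add: u')
      from conj_degeneracies_deg_filtration[OF \<gamma>(1,2) k \<gamma>(3) \<beta> this h] show ?thesis .
    next
      assume "h \<in> pairing_subgroup G d s (Suc m)"
      then show ?thesis
        using N.inv_op_closed2[OF aG] pairing_subgroup_deg_filtration by blast
    qed
    have hG: "h \<in> carrier ?H"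
      if "h \<in> degenerate_moore_images (Suc k) (Suc m) \<union> pairing_subgroup G d s (Suc m)" for h
      using that deg_filtration_gens_carrier by blast
    show ?thesis
      using c unfolding deg_filtration_def[of "Suc k" "Suc m"]
    proof (induction rule: generate.induct)
      case one
      then show ?case
        using aG by (simp add: generate.one)
    next
      case (incl h)
      then show ?case
        using base by (simp add: deg_filtration_def)
    next
      case (inv h)
      have "inv\<^bsub>?H\<^esub> (?conj (s m k u) h) \<in> ?M"
        using base[OF inv] by simp
      then show ?case
        using aG hG[OF inv] by (simp add: gr.inv_mult_group gr.m_assoc deg_filtration_def)
    next
      case (eng h1 h2)
      have h12: "h1 \<in> carrier ?H" "h2 \<in> carrier ?H"
        using eng.hyps M.mem_carrier by (auto simp: deg_filtration_def)
      have "?conj (s m k u) (h1 \<otimes>\<^bsub>?H\<^esub> h2) =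
          ?conj (s m k u) h1 \<otimes>\<^bsub>?H\<^esub> ?conj (s m k u) h2"
        using aG h12 by (rule gr.conj_mult)
      then show ?case
        using generate.eng[OF eng.IH] by simp
    qed
  qed
  have "\<forall>c\<in>?M. ?conj (s m k w) c \<in> ?M"
    using partial_moore_generated[OF w]
  proof (induction rule: generate.induct)
    case one
    then show ?case
      using k by (simp add: degeneracy_simps)
  next
    case (incl h)
    then show ?case
      using gen by blast
  next
    case (inv h)
    \<comment> \<open>The generators are closed under inverses, as \<open>s\<^sub>\<alpha>\<close> is a homomorphism.\<close>
    obtain \<gamma> x where \<gamma>: "\<gamma> \<in> index_strings m" "\<forall>i\<in>set \<gamma>. k \<le> i"
        "x \<in> moore G d (m - length \<gamma>)" and h: "h = degeneracies s (m - length \<gamma>) \<gamma> x"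
      using inv by (auto simp: moore_images_def)
    have len: "length \<gamma> \<le> m"
      using \<gamma>(1) by (rule length_index_strings)
    interpret g: group_hom "G (m - length \<gamma>)" "G m" "degeneracies s (m - length \<gamma>) \<gamma>"
      using degeneracies_hom[of \<gamma> "m - length \<gamma>"] \<gamma>(1) len
      by (simp add: group_hom_def group_hom_axioms_def is_group)
    have "inv\<^bsub>G (m - length \<gamma>)\<^esub> x \<in> moore G d (m - length \<gamma>)"
      using \<gamma>(3) subgroup.m_inv_closed[OF normal_imp_subgroup[OF moore_normal]] by blast
    moreover have "inv\<^bsub>G m\<^esub> h = degeneracies s (m - length \<gamma>) \<gamma> (inv\<^bsub>G (m - length \<gamma>)\<^esub> x)"
      using \<gamma>(3) by (simp add: h moore_def)
    ultimately have "inv\<^bsub>G m\<^esub> h \<in> moore_images k m"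
      using \<gamma>(1,2) unfolding moore_images_def by blast
    then show ?case
      using gen by blast
  next
    case (eng h1 h2)
    have h12: "h1 \<in> carrier (G m)" "h2 \<in> carrier (G m)"
      using eng.hyps gr.generate_in_carrier[OF moore_images_carrier] by auto
    show ?case
    proof
      fix c assume c: "c \<in> ?M"
      have "?conj (s m k (h1 \<otimes>\<^bsub>G m\<^esub> h2)) c = ?conj (s m k h1) (?conj (s m k h2) c)"
        using h12 k M.mem_carrier[OF c]
        by (simp add: degeneracy_simps gr.inv_mult_group gr.m_assoc)
      then show "?conj (s m k (h1 \<otimes>\<^bsub>G m\<^esub> h2)) c \<in> ?M"
        using eng.IH c by simp
    qed
  qed
  with c show ?thesis
    by blast
qed

text \<open>
  Although \<open>p\<^sub>k\<close> is no homomorphism, \<open>p\<^sub>k(z w) = p\<^sub>k z \<cdot> (s\<^sub>k d\<^sub>k z) (p\<^sub>k w) (s\<^sub>k d\<^sub>k z)\<^sup>-\<^sup>1\<close>.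
  As the elements \<open>s\<^sub>k d\<^sub>k z\<close> normalise the next group of the filtration, the elements
  that \<open>p\<^sub>k\<close> sends there form a subgroup, and checking generators suffices.
\<close>

lemma step_deg_filtration:
  assumes k: "k \<le> m" and z: "z \<in> deg_filtration k (Suc m)"
  shows "moore_proj_step G d s (Suc m) k z \<in> deg_filtration (Suc k) (Suc m)"
proof -
  let ?H = "G (Suc m)" and ?M = "deg_filtration (Suc k) (Suc m)"
  let ?p = "moore_proj_step G d s (Suc m) k" and ?e = "\<lambda>z. s m k (d (Suc m) k z)"
  let ?S = "{z \<in> partial_moore k (Suc m). ?p z \<in> ?M}"
  interpret M: subgroup ?M ?H
    by (rule deg_filtration_subgroup)
  interpret K: subgroup "partial_moore k (Suc m)" ?H
    by (rule partial_moore_subgroup)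
  have norm: "?e z \<otimes>\<^bsub>?H\<^esub> c \<otimes>\<^bsub>?H\<^esub> inv\<^bsub>?H\<^esub> ?e z \<in> ?M"
    if "z \<in> partial_moore k (Suc m)" "c \<in> ?M" for z c
    using that k by (intro degeneracy_normalizes_deg_filtration face_partial_moore) auto
  have e: "?e z \<in> carrier ?H" if "z \<in> carrier ?H" for z
    using that k by (simp add: face_simps degeneracy_simps)
  have "subgroup ?S ?H"
  proof (rule gr.subgroupI)
    show "?S \<noteq> {}"
      using k K.one_closed
      by (auto simp: step_Suc face_simps degeneracy_simps intro: exI[of _ "\<one>\<^bsub>?H\<^esub>"])
  next
    fix z assume z: "z \<in> ?S"
    then have zG: "z \<in> carrier ?H"
      by auto
    have "?p (inv\<^bsub>?H\<^esub> z) =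
        ?e (inv\<^bsub>?H\<^esub> z) \<otimes>\<^bsub>?H\<^esub> inv\<^bsub>?H\<^esub> ?p z \<otimes>\<^bsub>?H\<^esub> inv\<^bsub>?H\<^esub> ?e (inv\<^bsub>?H\<^esub> z)"
      using zG k e[OF zG]
      by (simp add: step_Suc face_simps degeneracy_simps gr.inv_mult_group gr.m_assoc[symmetric])
    with z norm[of "inv\<^bsub>?H\<^esub> z" "inv\<^bsub>?H\<^esub> ?p z"] show "inv\<^bsub>?H\<^esub> z \<in> ?S"
      by auto
  next
    fix z w assume zw: "z \<in> ?S" "w \<in> ?S"
    then have G: "z \<in> carrier ?H" "w \<in> carrier ?H"
      by auto
    have "?p (z \<otimes>\<^bsub>?H\<^esub> w) = ?p z \<otimes>\<^bsub>?H\<^esub> (?e z \<otimes>\<^bsub>?H\<^esub> ?p w \<otimes>\<^bsub>?H\<^esub> inv\<^bsub>?H\<^esub> ?e z)"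
      using G k e[OF G(1)] e[OF G(2)]
      by (simp add: step_Suc face_simps degeneracy_simps gr.inv_mult_group gr.m_assoc
          gr.inv_cancel_left)
    with zw norm[of z "?p w"] show "z \<otimes>\<^bsub>?H\<^esub> w \<in> ?S"
      by auto
  qed auto
  moreover have "degenerate_moore_images k (Suc m) \<union> pairing_subgroup G d s (Suc m) \<subseteq> ?S"
  proof
    fix z assume "z \<in> degenerate_moore_images k (Suc m) \<union> pairing_subgroup G d s (Suc m)"
    then show "z \<in> ?S"
    proof
      assume "z \<in> pairing_subgroup G d s (Suc m)"
      moreover from this have z: "z \<in> moore G d (Suc m)"
        using pairing_subgroup_moore by blast
      then have "z \<in> carrier ?H" "d (Suc m) k z = \<one>\<^bsub>G m\<^esub>"
        using k by (auto simp: moore_def kernel_def)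
      with k have "?p z = z"
        by (intro step_id)
      moreover have "z \<in> partial_moore k (Suc m)"
        using z moore_subset_partial_moore by blast
      ultimately show ?thesis
        using subsetD[OF pairing_subgroup_deg_filtration, of z "Suc m" "Suc k"] by simp
    next
      assume "z \<in> degenerate_moore_images k (Suc m)"
      then obtain \<alpha> x where \<alpha>: "\<alpha> \<in> index_strings (Suc m)" "\<alpha> \<noteq> []" "\<forall>i\<in>set \<alpha>. k \<le> i"
          "x \<in> moore G d (Suc m - length \<alpha>)"
          and z: "z = degeneracies s (Suc m - length \<alpha>) \<alpha> x"
        by (auto simp: degenerate_moore_images_def)
      have zK: "z \<in> partial_moore k (Suc m)"
        unfolding z using \<alpha> by (intro degeneracies_moore)
      show ?thesis
      proof (cases "k \<in> set \<alpha>")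
        case True
        have len: "length \<alpha> \<le> Suc m"
          using \<alpha>(1) by (rule length_index_strings)
        obtain u where u: "u \<in> partial_moore k m" "z = s m k u"
          using degeneracies_pull_out[of \<alpha> "Suc m - length \<alpha>" k k x] \<alpha> True len z
            moore_subset_partial_moore by fastforce
        then have "?p z = \<one>\<^bsub>?H\<^esub>"
          using k
          by (simp add: step_Suc face_degeneracy_same_Suc degeneracy_simps partial_moore_carrier)
        with zK show ?thesis
          by simp
      next
        case False
        then have ge: "\<forall>i\<in>set \<alpha>. Suc k \<le> i"
          using \<alpha>(3) by (metis Suc_leI le_neq_implies_less)
        then have "z \<in> partial_moore (Suc k) (Suc m)"
          unfolding z using \<alpha> by (intro degeneracies_moore)
        then have "?p z = z"
          using k by (simp add: step_id partial_moore_carrier partial_moore_face)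
        moreover have "z \<in> degenerate_moore_images (Suc k) (Suc m)"
          using ge \<alpha> z unfolding degenerate_moore_images_def by blast
        ultimately show ?thesis
          using zK subsetD[OF degenerate_moore_images_deg_filtration, of z "Suc k" "Suc m"]
          by simp
      qed
    qed
  qed
  ultimately have "deg_filtration k (Suc m) \<subseteq> ?S"
    unfolding deg_filtration_def[of k] by (intro gr.generate_subgroup_incl)
  with z show ?thesis
    by auto
qed

lemma moore_Int_degenerate_subgroup:
  assumes "z \<in> moore G d (Suc m)" "z \<in> degenerate_subgroup G s (Suc m)"
  shows "z \<in> pairing_subgroup G d s (Suc m)"
proof -
  \<comment> \<open>The steps of \<open>p\<close> fix \<open>z\<close>, since it lies in the Moore complex.\<close>
  have "z \<in> deg_filtration k (Suc m)" if "k \<le> Suc m" for k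
    using that
  proof (induction k)
    case 0
    then show ?case
      using assms(2) degenerate_subgroup_deg_filtration by blast
  next
    case (Suc k)
    then have "moore_proj_step G d s (Suc m) k z = z"
      using assms(1) by (intro step_id) (auto simp: moore_def kernel_def)
    then show ?case
      using step_deg_filtration[of k m z] Suc by simp
  qed
  from this[of "Suc m"] show ?thesis
    by (simp add: deg_filtration_top)
qed

end

theorem theorem2p1:
  fixes G :: "nat \<Rightarrow> ('a, 'b) monoid_scheme"
    and d s :: "nat \<Rightarrow> nat \<Rightarrow> 'a \<Rightarrow> 'a"
    and n :: nat
  assumes "simplicial_group G d s"
    and "n > 1"
  shows "moore G d n \<inter> degenerate_subgroup G s n =
         pairing_subgroup G d s n \<inter> degenerate_subgroup G s n"
proof -
  interpret simplicial_group G d s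
    by fact
  obtain m where "n = Suc m"
    using assms(2) by (cases n) auto
  then show ?thesis
    using moore_Int_degenerate_subgroup pairing_subgroup_moore by auto
qed

end
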